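(* The class $\mathcal{F}_H^0$ is closed under convex combinations: if $f_n\in\mathcal{F}_H^0$ for $n=1,2,\ldots$ and $t_n\in[0,1]$ satisfy $\sum_{n=1}^\infty t_n=1$, then $\sum_{n=1}^\infty t_nf_n\in\mathcal{F}_H^0$.
   Context: $\mathbb{D}=\{z\in\mathbb{C}:|z|<1\}$. $\mathcal{F}_H^0$ is the class of all complex-valued harmonic functions $f$ in $\mathbb{D}$ with $f(0)=0$, $f_z(0)=1$, $f_{\bar z}(0)=0$ and $|f_z(z)-1|<1-|f_{\bar z}(z)|$ for all $z\in\mathbb{D}$. *)

theory Defs
  imports "HOL-Analysis.Analysis"
begin

text \<open>Partial derivatives of a complex-valued function with respect to the real coordinates
  \<open>z = x + \<i> y\<close>. They are meaningful only where the function is (real) differentiable,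
  which is part of \<open>C1_on\<close> below.\<close>

definition partial_x :: "(complex \<Rightarrow> complex) \<Rightarrow> complex \<Rightarrow> complex" where
  "partial_x f z = frechet_derivative f (at z) 1"

definition partial_y :: "(complex \<Rightarrow> complex) \<Rightarrow> complex \<Rightarrow> complex" where
  "partial_y f z = frechet_derivative f (at z) \<i>"

definition wirtinger_z :: "(complex \<Rightarrow> complex) \<Rightarrow> complex \<Rightarrow> complex" where
  "wirtinger_z f z = (partial_x f z - \<i> * partial_y f z) / 2"

definition wirtinger_zbar :: "(complex \<Rightarrow> complex) \<Rightarrow> complex \<Rightarrow> complex" where
  "wirtinger_zbar f z = (partial_x f z + \<i> * partial_y f z) / 2"

text \<open>Continuous real differentiability; the set \<open>S\<close> is meant to be open.\<close>

definition C1_on :: "complex set \<Rightarrow> (complex \<Rightarrow> complex) \<Rightarrow> bool" where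
  "C1_on S f \<longleftrightarrow>
     (\<forall>z\<in>S. f differentiable (at z)) \<and>
     continuous_on S (partial_x f) \<and> continuous_on S (partial_y f)"

definition C2_on :: "complex set \<Rightarrow> (complex \<Rightarrow> complex) \<Rightarrow> bool" where
  "C2_on S f \<longleftrightarrow> C1_on S f \<and> C1_on S (partial_x f) \<and> C1_on S (partial_y f)"

definition harmonic_on :: "complex set \<Rightarrow> (complex \<Rightarrow> complex) \<Rightarrow> bool" where
  "harmonic_on S f \<longleftrightarrow>
     C2_on S f \<and>
     (\<forall>z\<in>S. partial_x (partial_x f) z + partial_y (partial_y f) z = 0)"

text \<open>Functions are total on the complex plane, but membership depends only
  on the values in the open unit disc.\<close>

definition class_FH0 :: "(complex \<Rightarrow> complex) set" where
  "class_FH0 =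
     {f. harmonic_on (ball 0 1) f \<and>
         f 0 = 0 \<and> wirtinger_z f 0 = 1 \<and> wirtinger_zbar f 0 = 0 \<and>
         (\<forall>z\<in>ball 0 1. cmod (wirtinger_z f z - 1) < 1 - cmod (wirtinger_zbar f z))}"

end

theory Submission
  imports Defs "HOL-Complex_Analysis.Cauchy_Integral_Formula"
begin

text \<open>
  A real differentiable function \<open>f\<close> is harmonic exactly when \<open>H = f\<^sub>z\<close> and \<open>G\<close>, the conjugate of the derivative
  of \<open>f\<close> with respect to \<open>cnj z\<close>, are holomorphic: its real differential is then
  \<open>v \<mapsto> H z * v + cnj (G z * v)\<close>
  (\<open>harmonic_derivative_holomorphic\<close> and its converse \<open>harmonic_on_if_derivative_holomorphic\<close>).
  The forward direction rests on the symmetry of second derivatives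
  (\<open>symmetric_second_derivative\<close>): the Cauchy-Riemann equations for \<open>H\<close> and \<open>G\<close> amount to
  Laplace's equation together with the equality of the mixed partial derivatives of \<open>f\<close>.

  The defining inequality \<open>\<bar>H - 1\<bar> < 1 - \<bar>G\<bar>\<close> bounds \<open>\<bar>H\<bar>\<close> by 2 and \<open>\<bar>G\<bar>\<close> by 1 for every
  member of the class. So the weighted series of the \<open>H n\<close> and of the \<open>G n\<close> converge
  uniformly on the whole disc, by the Weierstrass test, and their sums are holomorphic. As all
  \<open>f n\<close> vanish at 0, the series may be differentiated term by term: it converges on the disc,
  and its differential is given by the two holomorphic sums. Hence the sum is harmonic, and its
  Wirtinger derivatives are the sums of those of the \<open>f n\<close>. Finally the triangle inequality
  gives the defining inequality for the sum; it remains strict because some weight is positive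
  (\<open>convex_series_strict_bound\<close>).
\<close>

section \<open>Symmetry of second derivatives\<close>

text \<open>
  The second difference of \<open>f\<close> over the parallelogram spanned by \<open>s a\<close> and \<open>s b\<close> is an increment
  in the direction \<open>a\<close> of the function \<open>w \<mapsto> f (w + s b) - f w\<close>. Its derivative along
  the side \<open>s a\<close> is \<open>s\<close> times an increment of \<open>w \<mapsto> f' w a\<close>, which is \<open>s p' b\<close> to first order because
  \<open>p'\<close> is the differential of that map at \<open>z\<close>. The mean value inequality turns this into the
  estimate below. As \<open>p'\<close> describes that map only near \<open>z\<close>, both ends of its increment are
  compared with \<open>z\<close>, and the error is counted twice.
\<close>

lemma second_difference_bound:
  fixes f :: "'a::real_normed_vector \<Rightarrow> 'b::real_normed_vector"
  assumes "open S" "z \<in> S"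
    and f: "\<And>w. w \<in> S \<Longrightarrow> (f has_derivative f' w) (at w)"
    and p: "((\<lambda>w. f' w a) has_derivative p') (at z)"
    and "e > 0"
  shows "\<exists>d>0. \<forall>s. 0 < s \<and> s < d \<longrightarrow>
    norm (f (z + s *\<^sub>R a + s *\<^sub>R b) - f (z + s *\<^sub>R a) - (f (z + s *\<^sub>R b) - f z) - s\<^sup>2 *\<^sub>R p' b)
      \<le> e * s\<^sup>2"
proof -
  \<comment> \<open>Both ends of the increment lie within \<open>s * m\<close> of \<open>z\<close>, so the total error is at most
    \<open>2 * e' * (s * m) = e * s\<close> before the factor \<open>s\<close>; the summand 1 keeps \<open>m\<close> positive.\<close>
  define m where "m = norm a + norm b + 1"
  define e' where "e' = e / (2 * m)"
  have m: "m > 0" "norm a \<le> m" "norm b \<le> m" "norm a + norm b < m"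
    by (auto simp: m_def add_nonneg_pos)
  have e': "e' > 0" "2 * e' * m = e" using m \<open>e > 0\<close> by (auto simp: e'_def)
  interpret p': bounded_linear p' using p by (rule has_derivative_bounded_linear)
  obtain d1 where d1: "d1 > 0" "\<And>h. norm h < d1 \<Longrightarrow>
      norm (f' (z + h) a - f' z a - p' h) \<le> e' * norm h"
  proof -
    obtain d where "d > 0" and d: "\<forall>y. norm (y - z) < d \<longrightarrow>
        norm (f' y a - f' z a - p' (y - z)) \<le> e' * norm (y - z)"
      using p e'(1) unfolding has_derivative_within_alt by blast
    show thesis
      by (rule that[OF \<open>d > 0\<close>]) (use d in \<open>metis add_diff_cancel_left'\<close>)
  qed
  obtain d2 where d2: "d2 > 0" "ball z d2 \<subseteq> S"
    using assms(1,2) open_contains_ball by blast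
  define d where "d = min d1 d2 / m"
  have "d > 0" using d1 d2 m by (simp add: d_def)
  moreover have "norm (f (z + s *\<^sub>R a + s *\<^sub>R b) - f (z + s *\<^sub>R a) - (f (z + s *\<^sub>R b) - f z) - s\<^sup>2 *\<^sub>R p' b)
      \<le> e * s\<^sup>2" if s: "0 < s" "s < d" for s
  proof -
    have sm: "s * m < d1" "s * m < d2" using s m by (auto simp: d_def field_simps)
    \<comment> \<open>Subtracting the expected main term, linearly in \<open>t\<close>, leaves a path whose speed
      \<open>D t\<close> is only the error term.\<close>
    define \<phi> where "\<phi> t = f (z + (t * s) *\<^sub>R a + s *\<^sub>R b) - f (z + (t * s) *\<^sub>R a) - (t * s\<^sup>2) *\<^sub>R p' b"
      for t
    define D where "D t = s *\<^sub>R (f' (z + (t * s) *\<^sub>R a + s *\<^sub>R b) a - f' (z + (t * s) *\<^sub>R a) a - s *\<^sub>R p' b)"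
      for t
    have small: "norm ((t * s) *\<^sub>R a + s *\<^sub>R b) \<le> s * m" "norm ((t * s) *\<^sub>R a) \<le> s * m"
      if t: "t \<in> {0..1}" for t
    proof -
      have ts: "norm ((t * s) *\<^sub>R a) \<le> s * norm a"
        using t s by (simp add: abs_mult mult_left_le_one_le mult_right_mono)
      have *: "s * norm a \<le> s * m" "s * (norm a + norm b) \<le> s * m"
        using s m by (auto intro!: mult_left_mono)
      show "norm ((t * s) *\<^sub>R a) \<le> s * m" using ts *(1) by linarith
      have "norm ((t * s) *\<^sub>R a + s *\<^sub>R b) \<le> norm ((t * s) *\<^sub>R a) + norm (s *\<^sub>R b)"
        by (rule norm_triangle_ineq)
      also have "\<dots> \<le> s * norm a + s * norm b" using ts s by simp
      also have "\<dots> \<le> s * m" using *(2) by (simp add: algebra_simps)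
      finally show "norm ((t * s) *\<^sub>R a + s *\<^sub>R b) \<le> s * m" .
    qed
    have inS: "z + (t * s) *\<^sub>R a + s *\<^sub>R b \<in> S" "z + (t * s) *\<^sub>R a \<in> S" if t: "t \<in> {0..1}" for t
    proof -
      have "z + h \<in> S" if "norm h \<le> s * m" for h
        using that sm d2(2) by (auto simp: subset_iff dist_norm)
      then show "z + (t * s) *\<^sub>R a + s *\<^sub>R b \<in> S" "z + (t * s) *\<^sub>R a \<in> S"
        using small[OF t] by (auto simp: add.assoc)
    qed
    have D: "(\<phi> has_derivative (\<lambda>h. h *\<^sub>R D t)) (at t within {0..1})" if t: "t \<in> {0..1}" for t
    proof -
      note lin = has_derivative_linear[OF f[OF inS(1)[OF t]]] has_derivative_linear[OF f[OF inS(2)[OF t]]]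
      have 1: "((\<lambda>t. f (z + (t * s) *\<^sub>R a + s *\<^sub>R b)) has_derivative
          (\<lambda>h. f' (z + (t * s) *\<^sub>R a + s *\<^sub>R b) ((h * s) *\<^sub>R a))) (at t within {0..1})"
        by (rule has_derivative_compose[where g = f and x = t and
            f = "\<lambda>t. z + (t * s) *\<^sub>R a + s *\<^sub>R b", OF _ f[OF inS(1)[OF t]]])
           (auto intro!: derivative_eq_intros)
      have 2: "((\<lambda>t. f (z + (t * s) *\<^sub>R a)) has_derivative
          (\<lambda>h. f' (z + (t * s) *\<^sub>R a) ((h * s) *\<^sub>R a))) (at t within {0..1})"
        by (rule has_derivative_compose[where g = f and x = t and
            f = "\<lambda>t. z + (t * s) *\<^sub>R a", OF _ f[OF inS(2)[OF t]]])
           (auto intro!: derivative_eq_intros)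
      have 3: "((\<lambda>t. (t * s\<^sup>2) *\<^sub>R p' b) has_derivative (\<lambda>h. (h * s\<^sup>2) *\<^sub>R p' b)) (at t within {0..1})"
        by (auto intro!: derivative_eq_intros)
      show ?thesis
        using has_derivative_diff[OF has_derivative_diff[OF 1 2] 3]
        unfolding \<phi>_def D_def
        by (simp add: linear_scale[OF lin(1)] linear_scale[OF lin(2)]
            scaleR_diff_right power2_eq_square mult.assoc)
    qed
    have bound: "norm (D t) \<le> e * s\<^sup>2" if t: "t \<in> {0..1}" for t
    proof -
      let ?h1 = "(t * s) *\<^sub>R a + s *\<^sub>R b" and ?h2 = "(t * s) *\<^sub>R a"
      have le: "norm (f' (z + h) a - f' z a - p' h) \<le> e' * (s * m)" if "norm h \<le> s * m" for h
      proof -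
        have "norm (f' (z + h) a - f' z a - p' h) \<le> e' * norm h"
          using d1(2) that sm(1) by force
        also have "\<dots> \<le> e' * (s * m)" using that e' by (simp add: mult_left_mono)
        finally show ?thesis .
      qed
      have "f' (z + ?h1) a - f' (z + ?h2) a - s *\<^sub>R p' b =
          (f' (z + ?h1) a - f' z a - p' ?h1) - (f' (z + ?h2) a - f' z a - p' ?h2)"
        by (simp add: p'.add p'.scaleR)
      then have "norm (f' (z + ?h1) a - f' (z + ?h2) a - s *\<^sub>R p' b) \<le> e' * (s * m) + e' * (s * m)"
        using norm_triangle_ineq4 le small[OF t] by (smt (verit))
      also have "\<dots> = e * s" using e'(2) by (simp add: algebra_simps)
      finally have "s * norm (f' (z + ?h1) a - f' (z + ?h2) a - s *\<^sub>R p' b) \<le> s * (e * s)"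
        using s by simp
      then show ?thesis using s by (simp add: D_def add.assoc power2_eq_square mult_ac)
    qed
    have "norm (\<phi> 1 - \<phi> 0) \<le> (e * s\<^sup>2) * norm (1 - 0 :: real)"
    proof (rule differentiable_bound[OF _ D])
      fix t :: real assume t: "t \<in> {0..1}"
      show "onorm (\<lambda>h. h *\<^sub>R D t) \<le> e * s\<^sup>2"
        by (rule onorm_bound) (use bound[OF t] \<open>e > 0\<close> in \<open>auto simp: mult.commute intro!: mult_left_mono\<close>)
    qed auto
    then show ?thesis by (simp add: \<phi>_def algebra_simps)
  qed
  ultimately show ?thesis by blast
qed

text \<open>
  The second difference is symmetric in \<open>a\<close> and \<open>b\<close>, so after division by \<open>s\<^sup>2\<close> it tends both to
  \<open>p' b\<close> and to \<open>q' a\<close>.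
\<close>

lemma symmetric_second_derivative:
  fixes f :: "'a::real_normed_vector \<Rightarrow> 'b::real_normed_vector"
  assumes "open S" "z \<in> S"
    and "\<And>w. w \<in> S \<Longrightarrow> (f has_derivative f' w) (at w)"
    and p: "((\<lambda>w. f' w a) has_derivative p') (at z)"
    and q: "((\<lambda>w. f' w b) has_derivative q') (at z)"
  shows "p' b = q' a"
proof -
  have "norm (p' b - q' a) \<le> 0 + e" if "e > 0" for e
  proof -
    obtain d1 where d1: "d1 > 0" "\<And>s. 0 < s \<and> s < d1 \<Longrightarrow>
      norm (f (z + s *\<^sub>R a + s *\<^sub>R b) - f (z + s *\<^sub>R a) - (f (z + s *\<^sub>R b) - f z) - s\<^sup>2 *\<^sub>R p' b)
      \<le> e / 2 * s\<^sup>2"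
      using second_difference_bound[OF assms(1-3) p, where e = "e / 2" and b = b] \<open>e > 0\<close> by auto
    obtain d2 where d2: "d2 > 0" "\<And>s. 0 < s \<and> s < d2 \<Longrightarrow>
      norm (f (z + s *\<^sub>R b + s *\<^sub>R a) - f (z + s *\<^sub>R b) - (f (z + s *\<^sub>R a) - f z) - s\<^sup>2 *\<^sub>R q' a)
      \<le> e / 2 * s\<^sup>2"
      using second_difference_bound[OF assms(1-3) q, where e = "e / 2" and b = a] \<open>e > 0\<close> by auto
    define s where "s = min d1 d2 / 2"
    have s: "0 < s \<and> s < d1" "0 < s \<and> s < d2" using d1(1) d2(1) by (auto simp: s_def)
    define U where "U = f (z + s *\<^sub>R a + s *\<^sub>R b) - f (z + s *\<^sub>R a) - (f (z + s *\<^sub>R b) - f z)"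
    have U: "f (z + s *\<^sub>R b + s *\<^sub>R a) - f (z + s *\<^sub>R b) - (f (z + s *\<^sub>R a) - f z) = U"
      by (simp add: U_def algebra_simps)
    have "s\<^sup>2 *\<^sub>R (p' b - q' a) = (U - s\<^sup>2 *\<^sub>R q' a) - (U - s\<^sup>2 *\<^sub>R p' b)"
      by (simp add: algebra_simps)
    then have "norm (s\<^sup>2 *\<^sub>R (p' b - q' a)) \<le> e / 2 * s\<^sup>2 + e / 2 * s\<^sup>2"
      using d1(2)[OF s(1)] d2(2)[OF s(2)] unfolding U U_def[symmetric]
      by (smt (verit) norm_triangle_ineq4)
    then have "s\<^sup>2 * norm (p' b - q' a) \<le> s\<^sup>2 * e"
      unfolding norm_scaleR by (simp add: mult.commute)
    then show ?thesis using s by simp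
  qed
  then have "norm (p' b - q' a) \<le> 0" by (rule field_le_epsilon)
  then show ?thesis by simp
qed

section \<open>Harmonic functions and pairs of holomorphic functions\<close>

lemma partials_of_has_derivative:
  assumes "(f has_derivative D) (at z)"
  shows "partial_x f z = D 1" "partial_y f z = D \<i>"
  using frechet_derivative_at[OF assms] by (auto simp: partial_x_def partial_y_def)

lemma real_linear_complex_expand:
  fixes L :: "complex \<Rightarrow> complex"
  assumes "linear L"
  shows "L v = Re v * L 1 + Im v * L \<i>"
proof -
  have "L v = L (Re v *\<^sub>R 1 + Im v *\<^sub>R \<i>)"
    by (rule arg_cong[where f = L]) (simp add: complex_eq_iff)
  also have "\<dots> = Re v * L 1 + Im v * L \<i>"
    unfolding linear_add[OF assms] linear_scale[OF assms] by (simp add: scaleR_conv_of_real)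
  finally show ?thesis .
qed

lemma cauchy_riemann_field_derivative:
  assumes "(f has_derivative L) (at z)" "L \<i> = \<i> * L 1"
  shows "(f has_field_derivative L 1) (at z)"
proof -
  have "L = (*) (L 1)"
    by (rule ext, subst real_linear_complex_expand[OF has_derivative_linear[OF assms(1)]])
       (simp add: assms(2) complex_eq_iff algebra_simps)
  then show ?thesis using assms(1) by (simp add: has_field_derivative_def)
qed

text \<open>
  With \<open>P\<close> and \<open>Q\<close> the differentials of the two partial derivatives, symmetry says
  \<open>P \<i> = Q 1\<close> and Laplace's equation says \<open>Q \<i> = - P 1\<close>. These make the differential of
  \<open>wirtinger_z f\<close> complex linear and that of \<open>wirtinger_zbar f\<close> conjugate linear.
\<close>

lemma harmonic_derivative_holomorphic:
  assumes "open S" and f: "harmonic_on S f"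
  shows "wirtinger_z f holomorphic_on S"
    and "(\<lambda>z. cnj (wirtinger_zbar f z)) holomorphic_on S"
    and "\<And>z. z \<in> S \<Longrightarrow>
      (f has_derivative (\<lambda>v. wirtinger_z f z * v + wirtinger_zbar f z * cnj v)) (at z)"
proof -
  have df: "(f has_derivative frechet_derivative f (at z)) (at z)" if "z \<in> S" for z
    using f that unfolding harmonic_on_def C2_on_def C1_on_def frechet_derivative_works by blast
  show "(f has_derivative (\<lambda>v. wirtinger_z f z * v + wirtinger_zbar f z * cnj v)) (at z)"
    if "z \<in> S" for z
  proof -
    have "frechet_derivative f (at z) = (\<lambda>v. wirtinger_z f z * v + wirtinger_zbar f z * cnj v)"
      by (rule ext, subst real_linear_complex_expand[OF has_derivative_linear[OF df[OF that]]])
         (simp add: wirtinger_z_def wirtinger_zbar_def partial_x_def partial_y_def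
            complex_eq_iff field_simps)
    then show ?thesis using df[OF that] by simp
  qed
  have *: "(wirtinger_z f) field_differentiable at z \<and>
      (\<lambda>z. cnj (wirtinger_zbar f z)) field_differentiable at z" if z: "z \<in> S" for z
  proof -
    define P where "P = frechet_derivative (partial_x f) (at z)"
    define Q where "Q = frechet_derivative (partial_y f) (at z)"
    have P: "(partial_x f has_derivative P) (at z)" and Q: "(partial_y f has_derivative Q) (at z)"
      using f z unfolding harmonic_on_def C2_on_def C1_on_def frechet_derivative_works P_def Q_def
      by blast+
    have sym: "P \<i> = Q 1"
      using symmetric_second_derivative[OF assms(1) z df, of 1 P \<i> Q] P Q
      unfolding partial_x_def[abs_def] partial_y_def[abs_def] by simp
    have lap: "Q \<i> = - P 1"
      using f z unfolding harmonic_on_def by (simp add: P_def Q_def partial_x_def partial_y_def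
        add_eq_0_iff)
    have "(wirtinger_z f has_derivative (\<lambda>v. (P v - \<i> * Q v) / 2)) (at z)"
      unfolding wirtinger_z_def[abs_def] by (auto intro!: derivative_eq_intros P Q)
    from cauchy_riemann_field_derivative[OF this]
    have 1: "(wirtinger_z f) field_differentiable at z"
      by (auto simp: field_differentiable_def sym lap algebra_simps)
    have "((\<lambda>z. cnj (wirtinger_zbar f z)) has_derivative (\<lambda>v. cnj ((P v + \<i> * Q v) / 2))) (at z)"
      unfolding wirtinger_zbar_def[abs_def] by (auto intro!: derivative_eq_intros P Q)
    from cauchy_riemann_field_derivative[OF this]
    have 2: "(\<lambda>z. cnj (wirtinger_zbar f z)) field_differentiable at z"
      by (auto simp: field_differentiable_def sym lap algebra_simps diff_divide_distrib add_divide_distrib)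
    from 1 2 show ?thesis ..
  qed
  show "wirtinger_z f holomorphic_on S" "(\<lambda>z. cnj (wirtinger_zbar f z)) holomorphic_on S"
    using * by (auto simp: holomorphic_on_def field_differentiable_at_within)
qed

text \<open>
  The partial derivatives of \<open>f\<close> are \<open>H + cnj G\<close> and \<open>\<i> * (H - cnj G)\<close>. They inherit all
  smoothness from \<open>H\<close> and \<open>G\<close>, and differentiating once more in the same direction yields
  opposite values, because \<open>\<i>\<^sup>2 = -1\<close>.
\<close>

lemma harmonic_on_if_derivative_holomorphic:
  assumes "open S" and H: "H holomorphic_on S" and G: "G holomorphic_on S"
    and f: "\<And>z. z \<in> S \<Longrightarrow> (f has_derivative (\<lambda>v. H z * v + cnj (G z * v))) (at z)"
  shows "harmonic_on S f"
    and "\<And>z. z \<in> S \<Longrightarrow> wirtinger_z f z = H z"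
    and "\<And>z. z \<in> S \<Longrightarrow> wirtinger_zbar f z = cnj (G z)"
proof -
  have px: "partial_x f z = H z + cnj (G z)" and py: "partial_y f z = \<i> * (H z - cnj (G z))"
    if "z \<in> S" for z
    using partials_of_has_derivative[OF f[OF that]] by (auto simp: algebra_simps)
  show "wirtinger_z f z = H z" "wirtinger_zbar f z = cnj (G z)" if "z \<in> S" for z
    by (simp_all add: wirtinger_z_def wirtinger_zbar_def px[OF that] py[OF that])
  have cont: "continuous_on S H" "continuous_on S G"
      "continuous_on S (deriv H)" "continuous_on S (deriv G)"
    using H G assms(1) by (auto intro!: holomorphic_on_imp_continuous_on holomorphic_deriv)
  have dH: "(H has_derivative (*) (deriv H z)) (at z)"
    and dG: "(G has_derivative (*) (deriv G z)) (at z)" if "z \<in> S" for z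
    using holomorphic_derivI[OF H assms(1) that] holomorphic_derivI[OF G assms(1) that]
    by (auto simp: has_field_derivative_def)
  have dpx: "(partial_x f has_derivative (\<lambda>v. deriv H z * v + cnj (deriv G z * v))) (at z)"
    if z: "z \<in> S" for z
  proof (rule has_derivative_transform_within_open[OF _ assms(1) z])
    show "((\<lambda>z. H z + cnj (G z)) has_derivative (\<lambda>v. deriv H z * v + cnj (deriv G z * v))) (at z)"
      by (intro derivative_intros dH dG z)
  qed (use px in auto)
  have dpy: "(partial_y f has_derivative (\<lambda>v. \<i> * (deriv H z * v - cnj (deriv G z * v)))) (at z)"
    if z: "z \<in> S" for z
  proof (rule has_derivative_transform_within_open[OF _ assms(1) z])
    show "((\<lambda>z. \<i> * (H z - cnj (G z))) has_derivative
        (\<lambda>v. \<i> * (deriv H z * v - cnj (deriv G z * v)))) (at z)"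
      by (intro derivative_intros dH dG z)
  qed (use py in auto)
  have C1I: "C1_on S u" if "\<And>z. z \<in> S \<Longrightarrow> (u has_derivative D z) (at z)"
    "continuous_on S (\<lambda>z. D z 1)" "continuous_on S (\<lambda>z. D z \<i>)" for u D
    unfolding C1_on_def
  proof (intro conjI ballI)
    show "u differentiable at z" if "z \<in> S" for z
      using \<open>\<And>z. z \<in> S \<Longrightarrow> (u has_derivative D z) (at z)\<close>[OF that] by (auto simp: differentiable_def)
    show "continuous_on S (partial_x u)" "continuous_on S (partial_y u)"
      using that(2,3) partials_of_has_derivative[OF that(1)] by (simp_all cong: continuous_on_cong)
  qed
  have "C1_on S f" "C1_on S (partial_x f)" "C1_on S (partial_y f)"
    by (rule C1I[OF f] C1I[OF dpx] C1I[OF dpy], assumption, (intro continuous_intros cont)+)+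
  moreover have "partial_x (partial_x f) z + partial_y (partial_y f) z = 0" if "z \<in> S" for z
    using partials_of_has_derivative[OF dpx[OF that]] partials_of_has_derivative[OF dpy[OF that]]
    by (simp add: algebra_simps)
  ultimately show "harmonic_on S f" by (auto simp: harmonic_on_def C2_on_def)
qed

section \<open>Series with nonnegative weights\<close>

lemma weighted_series_uniform_limit:
  fixes h :: "nat \<Rightarrow> complex \<Rightarrow> complex"
  assumes "\<And>n z. z \<in> S \<Longrightarrow> cmod (h n z) \<le> B" and "\<And>n. t n \<ge> (0::real)" and "summable t"
  shows "uniform_limit S (\<lambda>n z. \<Sum>i<n. t i * h i z) (\<lambda>z. \<Sum>i. t i * h i z) sequentially"
proof (rule Weierstrass_m_test[where M = "\<lambda>n. t n * B"])
  show "cmod (t n * h n z) \<le> t n * B" if "z \<in> S" for n z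
    using mult_left_mono[OF assms(1)[OF that] assms(2)] assms(2)[of n] by (simp add: norm_mult)
  show "summable (\<lambda>n. t n * B)" by (rule summable_mult2[OF assms(3)])
qed

lemma weighted_series_holomorphic:
  fixes h :: "nat \<Rightarrow> complex \<Rightarrow> complex"
  assumes "open S" and h: "\<And>n. h n holomorphic_on S"
    and "\<And>n z. z \<in> S \<Longrightarrow> cmod (h n z) \<le> B" and "\<And>n. t n \<ge> (0::real)" and "summable t"
  shows "(\<lambda>z. \<Sum>n. t n * h n z) holomorphic_on S"
proof (rule holomorphic_uniform_sequence[OF assms(1)])
  show "(\<lambda>z. \<Sum>i<n. t i * h i z) holomorphic_on S" for n
    by (intro holomorphic_intros h)
  have lim: "uniform_limit S (\<lambda>n z. \<Sum>i<n. t i * h i z) (\<lambda>z. \<Sum>n. t n * h n z) sequentially"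
    by (rule weighted_series_uniform_limit[OF assms(3-5)])
  fix x assume "x \<in> S"
  then obtain d where "d > 0" "cball x d \<subseteq> S" using assms(1) open_contains_cball by blast
  then show "\<exists>d>0. cball x d \<subseteq> S \<and>
      uniform_limit (cball x d) (\<lambda>n z. \<Sum>i<n. t i * h i z) (\<lambda>z. \<Sum>n. t n * h n z) sequentially"
    using uniform_limit_on_subset[OF lim] by meson
qed

lemma weighted_series_abs_summable:
  fixes c :: "nat \<Rightarrow> complex" and t :: "nat \<Rightarrow> real"
  assumes "\<And>n. cmod (c n) \<le> B" and "\<And>n. t n \<ge> 0" and "summable t"
  shows "summable (\<lambda>n. cmod (t n * c n))"
proof (rule summable_comparison_test'[where g = "\<lambda>n. t n * B"])
  show "summable (\<lambda>n. t n * B)" by (rule summable_mult2[OF assms(3)])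
  show "norm (cmod (t n * c n)) \<le> t n * B" for n
    using mult_left_mono[OF assms(1,2)] assms(2)[of n] by (simp add: norm_mult)
qed

text \<open>
  The gap between the two sides is at least the sum of the weighted gaps
  \<open>t n * (1 - \<bar>c n - 1\<bar> - \<bar>d n\<bar>)\<close>. No term is negative, and a term with \<open>t n > 0\<close>, which exists
  since the weights add up to 1, is positive.
\<close>

lemma convex_series_strict_bound:
  fixes c d :: "nat \<Rightarrow> complex" and t :: "nat \<Rightarrow> real"
  assumes t: "\<And>n. t n \<ge> 0" "t sums 1"
    and cd: "\<And>n. cmod (c n - 1) < 1 - cmod (d n)"
  shows "cmod ((\<Sum>n. t n * c n) - 1) < 1 - cmod (\<Sum>n. t n * d n)"
proof -
  have st: "summable t" and t1: "suminf t = 1" using t(2) by (auto simp: sums_iff)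
  have c1: "cmod (c n - 1) \<le> 1" and d1: "cmod (d n) \<le> 1" for n
    using cd[of n] norm_ge_zero[of "c n - 1"] norm_ge_zero[of "d n"] by linarith+
  have sc: "summable (\<lambda>n. cmod (t n * (c n - 1)))" and sd: "summable (\<lambda>n. cmod (t n * d n))"
    using weighted_series_abs_summable[OF c1 t(1) st] weighted_series_abs_summable[OF d1 t(1) st] .
  have "(\<lambda>n. complex_of_real (t n)) sums of_real 1"
    using t(2) by (subst sums_of_real_iff)
  \<comment> \<open>Since the weights add up to 1, the subtraction of 1 can be moved inside the series.\<close>
  from sums_add[OF summable_sums[OF summable_norm_cancel[OF sc]] this]
  have "(\<lambda>n. t n * c n) sums ((\<Sum>n. t n * (c n - 1)) + 1)"
    by (simp add: algebra_simps)
  then have "(\<Sum>n. t n * c n) - 1 = (\<Sum>n. t n * (c n - 1))"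
    by (simp add: sums_iff)
  then have A: "cmod ((\<Sum>n. t n * c n) - 1) \<le> (\<Sum>n. cmod (t n * (c n - 1)))"
    using summable_norm[OF sc] by simp
  have B: "cmod (\<Sum>n. t n * d n) \<le> (\<Sum>n. cmod (t n * d n))"
    by (rule summable_norm[OF sd])
  define r where "r n = t n - cmod (t n * (c n - 1)) - cmod (t n * d n)" for n
  have r: "r n = t n * (1 - cmod (c n - 1) - cmod (d n))" for n
    using t(1)[of n] unfolding r_def norm_mult by (simp add: right_diff_distrib)
  have r0: "r n \<ge> 0" for n
    using t(1)[of n] cd[of n] by (auto simp: r)
  obtain k where "t k \<noteq> 0"
    using t1 by (metis suminf_zero zero_neq_one ext)
  then have "r k > 0"
    using t(1)[of k] cd[of k] by (auto simp: r)
  moreover have sr: "summable r" unfolding r_def by (intro summable_diff st sc sd)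
  ultimately have "0 < suminf r" using r0 by (metis suminf_pos_iff)
  also have "suminf r = 1 - (\<Sum>n. cmod (t n * (c n - 1))) - (\<Sum>n. cmod (t n * d n))"
    unfolding r_def
    by (simp add: suminf_diff[OF summable_diff[OF st sc] sd, symmetric] suminf_diff[OF st sc, symmetric] flip: t1)
  finally show ?thesis using A B by linarith
qed

theorem theorem4p9:
  fixes f :: "nat \<Rightarrow> complex \<Rightarrow> complex" and t :: "nat \<Rightarrow> real"
  assumes "\<And>n. f n \<in> class_FH0"
    and "\<And>n. t n \<in> {0..1}"
    and "t sums 1"
  shows "(\<forall>z\<in>ball 0 1. summable (\<lambda>n. complex_of_real (t n) * f n z)) \<and>
         (\<lambda>z. \<Sum>n. complex_of_real (t n) * f n z) \<in> class_FH0"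
proof -
  let ?D = "ball 0 1 :: complex set"
  define H where "H n = wirtinger_z (f n)" for n
  define G where "G n z = cnj (wirtinger_zbar (f n) z)" for n z
  define F where "F z = (\<Sum>n. t n * f n z)" for z
  define HH where "HH z = (\<Sum>n. t n * H n z)" for z
  define GG where "GG z = (\<Sum>n. t n * G n z)" for z
  have t0: "t n \<ge> 0" for n using assms(2)[of n] by simp
  have st: "summable t" using assms(3) by (simp add: sums_iff)
  have harm: "harmonic_on ?D (f n)" and f0: "f n 0 = 0" and H0: "H n 0 = 1" and G0: "G n 0 = 0" for n
    using assms(1)[of n] by (auto simp: class_FH0_def H_def G_def)
  have HG: "cmod (H n z - 1) < 1 - cmod (G n z)" if "z \<in> ?D" for n z
    using assms(1)[of n] that by (auto simp: class_FH0_def H_def G_def)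
  have Gb: "cmod (G n z) \<le> 1" if "z \<in> ?D" for n z
    using HG[OF that, of n] norm_ge_zero[of "H n z - 1"] by linarith
  have Hb: "cmod (H n z) \<le> 2" if "z \<in> ?D" for n z
    using HG[OF that, of n] norm_ge_zero[of "G n z"] norm_triangle_sub[of "H n z" 1]
    unfolding norm_one by linarith
  have holH: "H n holomorphic_on ?D" and holG: "G n holomorphic_on ?D" for n
    using harmonic_derivative_holomorphic(1,2)[OF open_ball harm]
    by (simp_all add: H_def G_def[abs_def])
  have df: "(f n has_derivative (\<lambda>v. H n z * v + cnj (G n z * v))) (at z)" if "z \<in> ?D" for n z
    using harmonic_derivative_holomorphic(3)[OF open_ball harm that] by (simp add: H_def G_def)
  have hol: "HH holomorphic_on ?D" "GG holomorphic_on ?D"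
    unfolding HH_def[abs_def] GG_def[abs_def]
    by (rule weighted_series_holomorphic[OF open_ball holH Hb t0 st]
        weighted_series_holomorphic[OF open_ball holG Gb t0 st]; assumption)+
  have ulim: "uniform_limit ?D (\<lambda>n z. \<Sum>i<n. t i * H i z) HH sequentially"
     "uniform_limit ?D (\<lambda>n z. \<Sum>i<n. t i * G i z) GG sequentially"
    unfolding HH_def[abs_def] GG_def[abs_def]
    by (rule weighted_series_uniform_limit[OF Hb t0 st] weighted_series_uniform_limit[OF Gb t0 st];
        assumption)+
  \<comment> \<open>Term-by-term differentiation, with convergence at the single point 0 as the anchor,
    gives convergence on all of the disc.\<close>
  have "\<exists>g. \<forall>z\<in>?D. (\<lambda>n. t n * f n z) sums g z \<and>
      (g has_derivative (\<lambda>v. HH z * v + cnj (GG z * v))) (at z within ?D)"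
  proof (rule has_derivative_series[where x = 0 and l = 0 and S = ?D
        and f = "\<lambda>n z. t n * f n z" and g' = "\<lambda>z v. HH z * v + cnj (GG z * v)"
        and f' = "\<lambda>n z v. t n * (H n z * v + cnj (G n z * v))"])
    show "((\<lambda>z. t n * f n z) has_derivative (\<lambda>v. t n * (H n z * v + cnj (G n z * v)))) (at z within ?D)"
      if "z \<in> ?D" for n z
      by (rule has_derivative_mult_right[OF has_derivative_at_withinI[OF df[OF that]]])
    show "\<forall>\<^sub>F n in sequentially. \<forall>z\<in>?D. \<forall>v.
        cmod ((\<Sum>i<n. t i * (H i z * v + cnj (G i z * v))) - (HH z * v + cnj (GG z * v))) \<le> e * cmod v"
      if "e > 0" for e
    proof -
      have "\<forall>\<^sub>F n in sequentially. \<forall>z\<in>?D. cmod ((\<Sum>i<n. t i * H i z) - HH z) < e / 2"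
        "\<forall>\<^sub>F n in sequentially. \<forall>z\<in>?D. cmod ((\<Sum>i<n. t i * G i z) - GG z) < e / 2"
        using ulim \<open>e > 0\<close> unfolding uniform_limit_iff dist_norm by (meson half_gt_zero)+
      then show ?thesis
      proof eventually_elim
        case (elim n)
        show ?case
        proof (intro ballI allI)
          fix z v assume z: "z \<in> ?D"
          let ?a = "(\<Sum>i<n. t i * H i z) - HH z" and ?b = "(\<Sum>i<n. t i * G i z) - GG z"
          have "(\<Sum>i<n. t i * (H i z * v + cnj (G i z * v))) - (HH z * v + cnj (GG z * v))
              = ?a * v + cnj (?b * v)"
            by (simp add: sum_distrib_left sum.distrib algebra_simps)
          also have "cmod \<dots> \<le> cmod ?a * cmod v + cmod ?b * cmod v"
            by (rule order_trans[OF norm_triangle_ineq]) (simp only: complex_mod_cnj norm_mult order_refl)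
          also have "\<dots> \<le> e / 2 * cmod v + e / 2 * cmod v"
            using elim z by (intro add_mono mult_right_mono) (auto intro: less_imp_le)
          finally show "cmod ((\<Sum>i<n. t i * (H i z * v + cnj (G i z * v))) - (HH z * v + cnj (GG z * v)))
              \<le> e * cmod v" by simp
        qed
      qed
    qed
  qed (auto simp: f0)
  then obtain g where g: "\<And>z. z \<in> ?D \<Longrightarrow> (\<lambda>n. t n * f n z) sums g z"
    "\<And>z. z \<in> ?D \<Longrightarrow> (g has_derivative (\<lambda>v. HH z * v + cnj (GG z * v))) (at z within ?D)"
    by blast
  have dF: "(F has_derivative (\<lambda>v. HH z * v + cnj (GG z * v))) (at z)" if z: "z \<in> ?D" for z
  proof (rule has_derivative_transform_within_open[OF _ open_ball z])
    show "(g has_derivative (\<lambda>v. HH z * v + cnj (GG z * v))) (at z)"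
      using g(2)[OF z] unfolding at_within_open[OF z open_ball] .
    show "g w = F w" if "w \<in> ?D" for w using g(1)[OF that] by (simp add: F_def sums_iff)
  qed
  note F = harmonic_on_if_derivative_holomorphic[OF open_ball hol dF]
  have "cmod (HH z - 1) < 1 - cmod (GG z)" if "z \<in> ?D" for z
    unfolding HH_def GG_def by (rule convex_series_strict_bound[OF t0 assms(3) HG[OF that]])
  moreover have "HH 0 = 1"
    using assms(3) sums_of_real_iff[of t 1, where 'a = complex] by (simp add: HH_def H0 sums_iff)
  ultimately have "F \<in> class_FH0"
    using F by (simp add: class_FH0_def) (simp add: F_def GG_def f0 G0)
  moreover have "summable (\<lambda>n. t n * f n z)" if "z \<in> ?D" for z
    using g(1)[OF that] by (simp add: sums_iff)
  ultimately show ?thesis unfolding F_def[abs_def] by blast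
qed

end
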